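(* Let $r\ge 0$ and $t,m,k\ge 1$ be integers and let $$T=\{r,r+1,\dots,r+t-1,\;r+m,r+m+1,\dots,r+m+t-1,\;\dots,\;r+km,r+km+1,\dots,r+km+t-1\}=\{r+jm+s:0\le j\le k,\ 0\le s\le t-1\}.$$ Then $V(T,t+k)\subseteq\mathbf{P}^{t+k-1}(\mathbf{C})$ contains $\binom{t+k}{k-1}(m-1)(m-2)\cdots(m-t)$ linear subspaces of dimension $k-1$.
   Context: For a finite set $U$ of $p$ nonnegative integers and variables $x_1,\dots,x_p$, $\Delta[U]$ is the determinant of the $p\times p$ matrix whose rows are $(x_1^i,\dots,x_p^i)$ for $i\in U$ (in increasing order); $\Delta_p=\Delta[\{0,\dots,p-1\}]$ is the Vandermonde determinant, and $f[U]=\Delta[U]/\Delta_p$, a homogeneous polynomial with integer coefficients. For a set $T$ of nonnegative integers and $N\ge 1$, $V(T,N)\subseteq\mathbf{P}^{N-1}$ is the common zero set of the $f[U]$ over all $U\subseteq T$ with $\#U=N$. *)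

theory Defs
  imports Complex_Main "HOL-Library.Poly_Mapping" "Jordan_Normal_Form.VS_Connect"
begin

text \<open>
  Multivariate polynomials with integer coefficients in the variables \<open>x\<^sub>0, x\<^sub>1, \<dots>\<close>: finitely
  supported maps from monomials (finitely supported exponent vectors) to coefficients, with the
  convolution product of \<^theory>\<open>HOL-Library.Poly_Mapping\<close>. The variables \<open>x\<^sub>1, \<dots>, x\<^sub>p\<close> of the
  mathematical text are \<open>x\<^sub>0, \<dots>, x\<^bsub>p-1\<^esub>\<close> here.
\<close>

type_synonym int_mpoly = "(nat \<Rightarrow>\<^sub>0 nat) \<Rightarrow>\<^sub>0 int"

definition mvar :: "nat \<Rightarrow> int_mpoly" where
  "mvar i = Poly_Mapping.single (Poly_Mapping.single i 1) 1"

definition mpoly_eval :: "(nat \<Rightarrow> complex) \<Rightarrow> int_mpoly \<Rightarrow> complex" where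
  "mpoly_eval a q =
     (\<Sum>e\<in>Poly_Mapping.keys q.
        of_int (Poly_Mapping.lookup q e) *
        (\<Prod>i\<in>Poly_Mapping.keys e. a i ^ Poly_Mapping.lookup e i))"

definition alternant :: "nat set \<Rightarrow> int_mpoly" where
  "alternant U =
     det (mat (card U) (card U) (\<lambda>(i, j). mvar j ^ (sorted_list_of_set U ! i)))"

definition vandermonde :: "nat \<Rightarrow> int_mpoly" where
  "vandermonde p = alternant {0..<p}"

text \<open>
  The quotient of the alternant by the Vandermonde determinant, taken in the polynomial ring. It is
  unique because that ring is an integral domain, and exists because the Vandermonde determinant
  divides every alternant.
\<close>

definition alternant_quotient :: "nat set \<Rightarrow> int_mpoly" where
  "alternant_quotient U = (THE q. q * vandermonde (card U) = alternant U)"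

text \<open>
  \<open>proj_space N\<close> is the projective space \<open>\<^bold>P\<^bsup>N-1\<^esup>(\<^bold>C)\<close>: it is indexed by the number \<open>N\<close> of homogeneous
  coordinates, and a point is the set of all its homogeneous coordinate vectors.
\<close>

definition proj_rel :: "nat \<Rightarrow> (complex vec \<times> complex vec) set" where
  "proj_rel N =
     {(v, w). v \<in> carrier_vec N - {0\<^sub>v N} \<and> w \<in> carrier_vec N - {0\<^sub>v N} \<and> (\<exists>c. c \<noteq> 0 \<and> w = c \<cdot>\<^sub>v v)}"

definition proj_space :: "nat \<Rightarrow> complex vec set set" where
  "proj_space N = (carrier_vec N - {0\<^sub>v N}) // proj_rel N"

definition proj_linear_subspace :: "nat \<Rightarrow> nat \<Rightarrow> complex vec set set \<Rightarrow> bool" where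
  "proj_linear_subspace N d L \<longleftrightarrow>
     (\<exists>W. VectorSpace.subspace class_ring W (module_vec TYPE(complex) N) \<and>
          vectorspace.dim class_ring (module_vec TYPE(complex) N\<lparr>carrier := W\<rparr>) = d + 1 \<and>
          L = {P \<in> proj_space N. P \<subseteq> W})"

definition V_locus :: "nat set \<Rightarrow> nat \<Rightarrow> complex vec set set" where
  "V_locus T N =
     {P \<in> proj_space N.
        \<forall>U. U \<subseteq> T \<and> finite U \<and> card U = N \<longrightarrow>
          (\<forall>v\<in>P. mpoly_eval (\<lambda>i. v $ i) (alternant_quotient U) = 0)}"

end

(*
  Choose t + 1 of the t + k coordinates and require that they be proportional to distinct m-th roots
  of unity. On this k-dimensional space of vectors every alternant with exponents in T vanishes,
  because the t + 1 chosen columns only involve exponents with t residues modulo m. The Vandermonde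
  determinant is nonzero at a generic vector of the space, so the quotient vanishes there, and by
  continuity everywhere. Normalising the root of unity at the least chosen coordinate to 1 leaves
  (m - 1)(m - 2)...(m - t) choices for the others.
*)

theory Submission
  imports Defs
begin

section \<open>Evaluation\<close>

text \<open>Updating at a key outside the support amounts to adding a \<open>single\<close>, so
  \<open>update_induct\<close> becomes an induction over terms, which suits additive maps such as
  \<open>mpoly_eval\<close>.\<close>

lemma poly_mapping_sum_induct [case_names zero add]:
  assumes "P 0" and "\<And>e c q. P q \<Longrightarrow> P (Poly_Mapping.single e c + q)"
  shows "P (q :: 'a \<Rightarrow>\<^sub>0 'b::comm_monoid_add)"
proof (induction q rule: update_induct)
  case const
  show ?case by fact
next
  case (update f a b)
  have "Poly_Mapping.update a b f = Poly_Mapping.single a b + f"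
    using update.hyps(1)
    by (intro poly_mapping_eqI) (auto simp: lookup_update lookup_add lookup_single in_keys_iff when_def)
  then show ?case using assms(2) update.IH by metis
qed

definition monomial_value :: "(nat \<Rightarrow> complex) \<Rightarrow> (nat \<Rightarrow>\<^sub>0 nat) \<Rightarrow> complex" where
  "monomial_value a e = (\<Prod>i\<in>Poly_Mapping.keys e. a i ^ Poly_Mapping.lookup e i)"

text \<open>Variables of exponent 0 contribute a factor 1. This allows two monomials to be
  multiplied over a common index set.\<close>

lemma monomial_value_superset:
  assumes "finite A" "Poly_Mapping.keys e \<subseteq> A"
  shows "monomial_value a e = (\<Prod>i\<in>A. a i ^ Poly_Mapping.lookup e i)"
  unfolding monomial_value_def
  by (rule prod.mono_neutral_left) (use assms in \<open>auto simp: in_keys_iff\<close>)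

lemma monomial_value_add: "monomial_value a (e + f) = monomial_value a e * monomial_value a f"
proof -
  let ?A = "Poly_Mapping.keys e \<union> Poly_Mapping.keys f"
  have "monomial_value a (e + f) = (\<Prod>i\<in>?A. a i ^ Poly_Mapping.lookup (e + f) i)"
    by (rule monomial_value_superset) (auto dest: subsetD[OF keys_add])
  also have "\<dots> = (\<Prod>i\<in>?A. a i ^ Poly_Mapping.lookup e i) * (\<Prod>i\<in>?A. a i ^ Poly_Mapping.lookup f i)"
    by (simp add: lookup_add power_add prod.distrib)
  also have "\<dots> = monomial_value a e * monomial_value a f"
    by (simp add: monomial_value_superset[of ?A])
  finally show ?thesis .
qed

lemma mpoly_eval_zero: "mpoly_eval a 0 = 0"
  by (simp add: mpoly_eval_def)

lemma mpoly_eval_add: "mpoly_eval a (p + q) = mpoly_eval a p + mpoly_eval a q"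
  unfolding mpoly_eval_def
  by (rule setsum_keys_plus_distrib) (auto simp: algebra_simps)

lemma mpoly_eval_single: "mpoly_eval a (Poly_Mapping.single e c) = of_int c * monomial_value a e"
  by (cases "c = 0") (auto simp: mpoly_eval_def monomial_value_def)

lemma mpoly_eval_mult: "mpoly_eval a (p * q) = mpoly_eval a p * mpoly_eval a q"
proof (induction p rule: poly_mapping_sum_induct)
  case zero
  then show ?case by (simp add: mpoly_eval_zero)
next
  case (add e c p)
  have "mpoly_eval a (Poly_Mapping.single e c * q) = mpoly_eval a (Poly_Mapping.single e c) * mpoly_eval a q"
    by (induction q rule: poly_mapping_sum_induct)
      (simp_all add: mpoly_eval_zero mpoly_eval_add mpoly_eval_single distrib_left mult_single
        monomial_value_add)
  with add show ?case by (simp add: mpoly_eval_add distrib_right)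
qed

lemma mpoly_eval_one: "mpoly_eval a 1 = 1"
  by (simp add: single_one[symmetric] mpoly_eval_single monomial_value_def del: single_one)

interpretation mpoly_eval: comm_ring_hom "mpoly_eval a"
  by unfold_locales (simp_all add: mpoly_eval_zero mpoly_eval_one mpoly_eval_add mpoly_eval_mult)

lemma mpoly_eval_mvar: "mpoly_eval a (mvar i) = a i"
  by (simp add: mvar_def mpoly_eval_single monomial_value_def)

text \<open>Continuity of evaluation in limit form, for the passage from generic vectors of a
  subspace to all of them.\<close>

lemma tendsto_mpoly_eval:
  assumes "\<And>i. ((\<lambda>z. a z i) \<longlongrightarrow> b i) F"
  shows "((\<lambda>z. mpoly_eval (a z) q) \<longlongrightarrow> mpoly_eval b q) F"
  unfolding mpoly_eval_def by (intro tendsto_intros assms)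

section \<open>Alternants and the Vandermonde determinant\<close>

text \<open>Powers of the \<open>x j\<close> are reduced modulo the monic polynomial with roots \<open>x j\<close>.\<close>

lemma power_eq_low_powers:
  fixes x :: "nat \<Rightarrow> 'a::idom"
  shows "\<exists>c. \<forall>j<p. x j ^ u = (\<Sum>l<p. c l * x j ^ l)"
proof (induction u)
  case 0
  show ?case
  proof (cases "p = 0")
    case False
    show ?thesis
    proof (intro exI[of _ "\<lambda>l. if l = 0 then 1 else 0"] allI impI)
      fix j
      have "(\<Sum>l<p. (if l = 0 then 1 else 0) * x j ^ l) = (\<Sum>l\<in>{0}. (if l = 0 then 1 else 0) * x j ^ l)"
        by (rule sum.mono_neutral_right) (use False in auto)
      then show "x j ^ 0 = (\<Sum>l<p. (if l = 0 then 1 else 0) * x j ^ l)" by simp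
    qed
  qed auto
next
  case (Suc u)
  then obtain c where c: "x j ^ u = (\<Sum>l<p. c l * x j ^ l)" if "j < p" for j by blast
  \<comment> \<open>\<open>P\<close> is monic of degree \<open>p\<close> and vanishes at every
    \<open>x j\<close>, so it rewrites the power \<open>p\<close> through lower ones with
    coefficients independent of \<open>j\<close>.\<close>
  define P where "P = (\<Prod>j<p. [:- x j, 1:])"
  have deg: "degree P = p"
    unfolding P_def by (subst degree_prod_sum_eq) auto
  have "lead_coeff P = 1"
    unfolding P_def by (simp add: lead_coeff_prod)
  then have lead: "coeff P p = 1" using deg by simp
  have P_root: "x j ^ p = (\<Sum>l<p. - coeff P l * x j ^ l)" if "j < p" for j
  proof -
    have "0 = poly P (x j)" using that by (auto simp: P_def poly_prod)
    also have "\<dots> = (\<Sum>l\<le>p. coeff P l * x j ^ l)" by (simp add: poly_altdef deg)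
    also have "\<dots> = (\<Sum>l<p. coeff P l * x j ^ l) + x j ^ p"
      by (simp add: lessThan_Suc_atMost[symmetric] lead)
    finally show ?thesis by (simp add: sum_negf eq_neg_iff_add_eq_0 add.commute)
  qed
  show ?case
  proof (cases p)
    case 0
    then show ?thesis by simp
  next
    case (Suc p')
    \<comment> \<open>Multiplication by \<open>x j\<close> shifts the coefficients \<open>c\<close>
      up by one; the overflowing top term \<open>c p' * x j ^ p\<close> is replaced by means of
      \<open>P_root\<close>.\<close>
    show ?thesis
    proof (intro exI[of _ "\<lambda>l. (case l of 0 \<Rightarrow> 0 | Suc l' \<Rightarrow> c l') - c p' * coeff P l"] allI impI)
      fix j assume j: "j < p"
      have "x j ^ Suc u = (\<Sum>l<p. c l * x j ^ Suc l)"
        by (simp add: c[OF j] sum_distrib_left mult_ac)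
      also have "\<dots> = (\<Sum>l<p'. c l * x j ^ Suc l) + c p' * x j ^ p" by (simp add: Suc)
      also have "(\<Sum>l<p'. c l * x j ^ Suc l) = (\<Sum>l<p. (case l of 0 \<Rightarrow> 0 | Suc l' \<Rightarrow> c l') * x j ^ l)"
        unfolding Suc by (subst sum.lessThan_Suc_shift) simp
      finally show "x j ^ Suc u =
          (\<Sum>l<p. ((case l of 0 \<Rightarrow> 0 | Suc l' \<Rightarrow> c l') - c p' * coeff P l) * x j ^ l)"
        by (simp add: P_root[OF j] sum_distrib_left sum_subtractf sum_negf algebra_simps)
    qed
  qed
qed

text \<open>The reduction coefficients do not depend on the column, so the matrix of powers factors
  as a coefficient matrix times the Vandermonde matrix, and \<open>det\<close> is multiplicative.
  Working over any \<open>idom\<close> covers the polynomial ring itself.\<close>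

lemma vandermonde_matrix_dvd:
  fixes x :: "nat \<Rightarrow> 'a::idom"
  shows "det (mat p p (\<lambda>(i, j). x j ^ i)) dvd det (mat p p (\<lambda>(i, j). x j ^ e i))"
proof -
  have "\<forall>i. \<exists>c. \<forall>j<p. x j ^ e i = (\<Sum>l<p. c l * x j ^ l)"
    using power_eq_low_powers by blast
  then obtain c where c: "x j ^ e i = (\<Sum>l<p. c i l * x j ^ l)" if "j < p" for i j
    by metis
  have "mat p p (\<lambda>(i, j). x j ^ e i) = mat p p (\<lambda>(i, l). c i l) * mat p p (\<lambda>(i, j). x j ^ i)"
    by (rule eq_matI) (auto simp: scalar_prod_def c atLeast0LessThan)
  then show ?thesis
    by (simp add: det_mult[of _ p])
qed

text \<open>A kernel vector of the transpose lists the coefficients of a nonzero polynomial of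
  degree below \<open>n\<close> with the \<open>n\<close> distinct roots \<open>a j\<close>, which
  is impossible.\<close>

lemma det_vandermonde_nonzero:
  fixes a :: "nat \<Rightarrow> 'a::field"
  assumes "inj_on a {..<n}"
  shows "det (mat n n (\<lambda>(i, j). a j ^ i)) \<noteq> 0"
proof
  let ?V = "mat n n (\<lambda>(i, j). a j ^ i)"
  assume "det ?V = 0"
  then have "det (transpose_mat ?V) = 0" by (simp add: det_transpose[of _ n])
  then obtain v where v: "v \<in> carrier_vec n" "v \<noteq> 0\<^sub>v n" "transpose_mat ?V *\<^sub>v v = 0\<^sub>v n"
    using det_0_iff_vec_prod_zero_field[of "transpose_mat ?V" n] by auto
  define P where "P = (\<Sum>i<n. monom (v $ i) i)"
  have coeff: "coeff P i = (if i < n then v $ i else 0)" for i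
    by (simp add: P_def coeff_sum sum.delta if_distrib cong: if_cong)
  obtain i where i: "i < n" "v $ i \<noteq> 0"
    using v(1,2) by (metis carrier_vecD eq_vecI index_zero_vec)
  then have "P \<noteq> 0" using coeff[of i] by auto
  have "poly P (a j) = 0" if "j < n" for j
  proof -
    have "(transpose_mat ?V *\<^sub>v v) $ j = 0" using v(3) that by simp
    then show ?thesis
      using that v(1) by (simp add: P_def poly_sum poly_monom scalar_prod_def atLeast0LessThan mult.commute)
  qed
  then have "a ` {..<n} \<subseteq> {x. poly P x = 0}" by auto
  then have "card (a ` {..<n}) \<le> card {x. poly P x = 0}"
    using \<open>P \<noteq> 0\<close> by (intro card_mono poly_roots_finite)
  also have "\<dots> \<le> degree P" using \<open>P \<noteq> 0\<close> by (rule card_poly_roots_bound)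
  also have "degree P < n" by (rule degree_lessI) (use i coeff in auto)
  finally show False using assms by (simp add: card_image)
qed

lemma mpoly_eval_alternant:
  "mpoly_eval a (alternant U) =
    det (mat (card U) (card U) (\<lambda>(i, j). a j ^ (sorted_list_of_set U ! i)))"
proof -
  have "map_mat (mpoly_eval a) (mat (card U) (card U) (\<lambda>(i, j). mvar j ^ (sorted_list_of_set U ! i)))
      = mat (card U) (card U) (\<lambda>(i, j). a j ^ (sorted_list_of_set U ! i))"
    by (rule eq_matI) (auto simp: mpoly_eval.hom_power mpoly_eval_mvar)
  then show ?thesis unfolding alternant_def by (metis mpoly_eval.hom_det)
qed

lemma vandermonde_eq: "vandermonde p = det (mat p p (\<lambda>(i, j). mvar j ^ i))"
  unfolding vandermonde_def alternant_def
  by (rule arg_cong[where f = det], rule eq_matI) auto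

lemma mpoly_eval_vandermonde_nonzero:
  assumes "inj_on a {..<p}"
  shows "mpoly_eval a (vandermonde p) \<noteq> 0"
proof -
  have "map_mat (mpoly_eval a) (mat p p (\<lambda>(i, j). mvar j ^ i)) = mat p p (\<lambda>(i, j). a j ^ i)"
    by (rule eq_matI) (auto simp: mpoly_eval.hom_power mpoly_eval_mvar)
  then show ?thesis
    using det_vandermonde_nonzero[OF assms] by (metis vandermonde_eq mpoly_eval.hom_det)
qed

lemma vandermonde_nonzero: "vandermonde p \<noteq> 0"
proof -
  have "inj_on (of_nat :: nat \<Rightarrow> complex) {..<p}" by (simp add: inj_on_def)
  from mpoly_eval_vandermonde_nonzero[OF this] show ?thesis
    by (auto simp: mpoly_eval_zero)
qed

text \<open>Makes the definite description usable: divisibility gives existence, and cancelling the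
  nonzero Vandermonde determinant gives uniqueness.\<close>

lemma alternant_quotient_mult: "alternant_quotient U * vandermonde (card U) = alternant U"
proof -
  have "vandermonde (card U) dvd alternant U"
    unfolding vandermonde_eq alternant_def by (rule vandermonde_matrix_dvd)
  then obtain q where "alternant U = vandermonde (card U) * q" ..
  then have "q * vandermonde (card U) = alternant U" by (simp add: mult.commute)
  then have "\<exists>!q. q * vandermonde (card U) = alternant U"
    using vandermonde_nonzero by (metis mult_right_cancel)
  then show ?thesis unfolding alternant_quotient_def by (rule theI')
qed


section \<open>The linear subspaces\<close>

text \<open>The coordinate \<open>p\<close> is the reference whose root is normalised to 1; in the
  uses below it lies outside \<open>A\<close>.\<close>

definition proportional_subspace :: "nat \<Rightarrow> nat \<Rightarrow> nat set \<Rightarrow> (nat \<Rightarrow> complex) \<Rightarrow> complex vec set" where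
  "proportional_subspace N p A \<zeta> = {v \<in> carrier_vec N. \<forall>i\<in>A. v $ i = \<zeta> i * v $ p}"

lemma proportional_subspace_subspace:
  assumes "A \<subseteq> {..<N}" "p < N"
  shows "VectorSpace.subspace class_ring (proportional_subspace N p A \<zeta>) (module_vec TYPE(complex) N)"
  unfolding VectorSpace.subspace_def
proof
  show "vectorspace class_ring (module_vec TYPE(complex) N)" by (rule vec_vs)
  show "submodule class_ring (proportional_subspace N p A \<zeta>) (module_vec TYPE(complex) N)"
    unfolding submodule_def using assms
    by (auto simp: vec_module module_vec_simps proportional_subspace_def distrib_left subset_iff)
qed

text \<open>The coordinates outside \<open>A\<close>, among them \<open>p\<close>, are free and
  determine the rest, which gives a linear bijection from a coordinate space of dimension
  \<open>N - card A\<close>.\<close>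

lemma dim_proportional_subspace:
  assumes A: "A \<subseteq> {..<N}" and p: "p < N" "p \<notin> A"
  shows "vectorspace.dim class_ring
    (module_vec TYPE(complex) N\<lparr>carrier := proportional_subspace N p A \<zeta>\<rparr>) = N - card A"
proof -
  define k where "k = N - card A"
  let ?W = "proportional_subspace N p A \<zeta>"
  let ?VW = "module_vec TYPE(complex) N\<lparr>carrier := ?W\<rparr>"
  have finA: "finite A" using A finite_subset by blast
  have "card ({..<N} - A) = card {..<k}"
    using A finA by (simp add: card_Diff_subset k_def)
  then obtain h where h: "bij_betw h ({..<N} - A) {..<k}"
    using bij_betw_iff_card[of "{..<N} - A" "{..<k}"] by auto
  define g where "g = the_inv_into ({..<N} - A) h"
  have g: "bij_betw g {..<k} ({..<N} - A)" unfolding g_def using h by (rule bij_betw_the_inv_into)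
  have hg: "h (g j) = j" if "j < k" for j
    using that h f_the_inv_into_f_bij_betw g_def by fastforce
  have gh: "g (h i) = i" if "i < N" "i \<notin> A" for i
    using that h by (auto simp: g_def bij_betw_def the_inv_into_f_f)
  have h_less: "h i < k" if "i < N" "i \<notin> A" for i
    using h that by (auto simp: bij_betw_def)
  have g_less: "g j < N" "g j \<notin> A" if "j < k" for j
    using g that by (auto simp: bij_betw_def)
  \<comment> \<open>\<open>h\<close> numbers the free coordinates. \<open>T\<close> spreads the
    entries of \<open>a\<close> over them and fills \<open>A\<close> with multiples of the entry at
    \<open>p\<close>, which is \<open>a $ h p\<close>.\<close>
  define T where "T = (\<lambda>a :: complex vec. vec N (\<lambda>i. if i \<in> A then \<zeta> i * a $ h p else a $ h i))"
  have T_W: "T a \<in> ?W" for a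
    using A p by (auto simp: T_def proportional_subspace_def)
  interpret V: vec_space "TYPE(complex)" k .
  have vsW: "vectorspace class_ring ?VW"
    by (rule vectorspace.subspace_is_vs[OF vec_vs proportional_subspace_subspace]) (use A p in auto)
  have hp: "h p < k" using h_less p by blast
  have "linear_map class_ring (module_vec TYPE(complex) k) ?VW T"
  proof (intro linear_map.intro mod_hom.intro mod_hom_axioms.intro)
    show "module class_ring ?VW" using vsW by (simp add: vectorspace_def)
    show "T \<in> LinearCombinations.module_hom class_ring (module_vec TYPE(complex) k) ?VW"
      using T_W hp h_less
      by (auto simp: LinearCombinations.module_hom_def module_vec_simps T_def distrib_left intro!: eq_vecI)
  qed (rule vec_vs vsW vec_module)+
  then interpret T: linear_map class_ring "module_vec TYPE(complex) k" ?VW T .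
  have inj: "inj_on T (carrier_vec k)"
  proof (rule inj_onI)
    fix a b :: "complex vec"
    assume ab: "a \<in> carrier_vec k" "b \<in> carrier_vec k" and eq: "T a = T b"
    show "a = b"
    proof (rule eq_vecI)
      fix j assume "j < dim_vec b"
      then have j: "j < k" using ab by simp
      have "T a $ g j = T b $ g j" using eq by simp
      then show "a $ j = b $ j" using g_less[OF j] hg[OF j] by (simp add: T_def)
    qed (use ab in auto)
  qed
  have surj: "T ` carrier_vec k = ?W"
  proof
    show "T ` carrier_vec k \<subseteq> ?W" using T_W by auto
    show "?W \<subseteq> T ` carrier_vec k"
    proof
      fix v assume v: "v \<in> ?W"
      have "v = T (vec k (\<lambda>j. v $ g j))"
      proof (rule eq_vecI)
        fix i assume "i < dim_vec (T (vec k (\<lambda>j. v $ g j)))"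
        then have i: "i < N" by (simp add: T_def)
        show "v $ i = T (vec k (\<lambda>j. v $ g j)) $ i"
        proof (cases "i \<in> A")
          case True
          then have "v $ i = \<zeta> i * v $ p" using v by (simp add: proportional_subspace_def)
          then show ?thesis using True i hp gh[OF p] by (simp add: T_def)
        next
          case False
          then show ?thesis using i h_less[OF i False] gh[OF i False] by (simp add: T_def)
        qed
      qed (use v in \<open>simp add: T_def proportional_subspace_def\<close>)
      then show "v \<in> T ` carrier_vec k" by (rule image_eqI) simp
    qed
  qed
  have "V.dim = vectorspace.dim class_ring ?VW"
    by (rule T.dim_eq) (use inj surj in \<open>auto simp: module_vec_simps\<close>)
  with V.dim_is_n show ?thesis unfolding k_def[symmetric] by simp
qed

section \<open>Vanishing of the alternants and their quotients on the subspaces\<close>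

text \<open>The exponents in \<open>T\<close> only take the \<open>t\<close> residues \<open>r, \<dots>, r + t - 1\<close> modulo \<open>m\<close>, so
  the \<open>t + 1\<close> columns in \<open>insert p A\<close> span at most \<open>t\<close> dimensions.\<close>

lemma alternant_zero_on_proportional_subspace:
  assumes A: "A \<subseteq> {..<N}" "card A = t" and p: "p < N" "p \<notin> A"
    and \<zeta>: "\<And>i. i \<in> A \<Longrightarrow> \<zeta> i ^ m = 1"
    and v: "v \<in> proportional_subspace N p A \<zeta>"
    and U: "card U = N" "finite U" "\<And>u. u \<in> U \<Longrightarrow> \<exists>j s. u = r + j * m + s \<and> s < t"
  shows "mpoly_eval (\<lambda>i. v $ i) (alternant U) = 0"
proof -
  have finA: "finite A" using A finite_subset by blast
  \<comment> \<open>\<open>h\<close> numbers \<open>A\<close> by 0, ..., t - 1, so that each of the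
    \<open>t\<close> residues is assigned a row of \<open>B\<close> below.\<close>
  obtain h where h: "bij_betw h A {..<t}"
    using finA A(2) bij_betw_iff_card[of A "{..<t}"] by auto
  define \<xi> where "\<xi> i = (if i \<in> A then \<zeta> i else 1)" for i
  have \<xi>: "\<xi> i ^ m = 1" for i using \<zeta> by (simp add: \<xi>_def)
  have v_eq: "v $ i = \<xi> i * v $ p" if "i \<in> insert p A" for i
    using v that p by (auto simp: proportional_subspace_def \<xi>_def)
  \<comment> \<open>\<open>B\<close> encodes the conditions on a column relation \<open>q\<close>:
    rows in \<open>A\<close> make \<open>q\<close> annihilate the powers of \<xi> for each residue,
    rows outside \<open>insert p A\<close> force the entry of \<open>q\<close> there to be 0. Row
    \<open>p\<close> is zero, so N - 1 conditions on N unknowns leave a nonzero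
    \<open>q\<close>.\<close>
  define B where "B = mat N N (\<lambda>(i, j).
    if i = p then 0
    else if i \<in> A then (if j \<in> insert p A then \<xi> j ^ (r + h i) else 0)
    else if j = i then 1 else 0)"
  have B: "B \<in> carrier_mat N N" by (simp add: B_def)
  have "row B p = 0\<^sub>v N" using p by (auto simp: B_def)
  then have "B = mat\<^sub>r N N (\<lambda>i. if i = p then 0\<^sub>v N else row B i)"
    by (intro eq_matI) (auto simp: B_def)
  then have "det B = 0"
    using det_row_0[OF p(1), of "\<lambda>i. row B i"] B by simp
  then obtain q where q: "q \<in> carrier_vec N" "q \<noteq> 0\<^sub>v N" "B *\<^sub>v q = 0\<^sub>v N"
    using det_0_iff_vec_prod_zero_field[OF B] by blast
  have q_row: "(\<Sum>j<N. B $$ (i, j) * q $ j) = 0" if "i < N" for i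
  proof -
    have "(B *\<^sub>v q) $ i = 0" using q(3) that by simp
    then show ?thesis using that q(1) B by (simp add: scalar_prod_def atLeast0LessThan)
  qed
  have q_outside: "q $ i = 0" if "i < N" "i \<notin> insert p A" for i
  proof -
    have "(\<Sum>j<N. B $$ (i, j) * q $ j) = (\<Sum>j<N. if j = i then q $ j else 0)"
      by (rule sum.cong) (use that in \<open>auto simp: B_def\<close>)
    then show ?thesis using q_row[OF that(1)] that by simp
  qed
  have q_pow: "(\<Sum>j\<in>insert p A. \<xi> j ^ (r + s) * q $ j) = 0" if "s < t" for s
  proof -
    have "s \<in> h ` A" using h that by (simp add: bij_betw_def)
    then obtain i where i: "i \<in> A" "h i = s" by blast
    then have "i < N" "i \<noteq> p" using A p by auto
    have "(\<Sum>j<N. B $$ (i, j) * q $ j) = (\<Sum>j\<in>insert p A. \<xi> j ^ (r + s) * q $ j)"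
      by (rule sum.mono_neutral_cong_right)
        (use A p i \<open>i < N\<close> \<open>i \<noteq> p\<close> in \<open>auto simp: B_def\<close>)
    then show ?thesis using q_row[OF \<open>i < N\<close>] by simp
  qed
  let ?M = "mat N N (\<lambda>(i, j). v $ j ^ (sorted_list_of_set U ! i))"
  have "?M *\<^sub>v q = 0\<^sub>v N"
  proof (rule eq_vecI)
    fix i assume "i < dim_vec (0\<^sub>v N :: complex vec)"
    then have i: "i < N" by simp
    define u where "u = sorted_list_of_set U ! i"
    have "u \<in> U" using U i unfolding u_def
      by (metis nth_mem set_sorted_list_of_set length_sorted_list_of_set)
    then obtain j' s where u: "u = r + j' * m + s" and s: "s < t" using U(3) by blast
    \<comment> \<open>Multiples of \<open>m\<close> in the exponent disappear, so row
      \<open>u\<close> restricted to \<open>insert p A\<close> is a multiple, by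
      \<open>v $ p ^ u\<close>, of a row already annihilated by \<open>q\<close>.\<close>
    have \<xi>_u: "\<xi> j ^ u = \<xi> j ^ (r + s)" for j
      using \<xi>[of j] by (simp add: u power_add power_mult mult.commute[of j'])
    have "(?M *\<^sub>v q) $ i = (\<Sum>j<N. v $ j ^ u * q $ j)"
      using i q(1) by (simp add: scalar_prod_def atLeast0LessThan u_def)
    also have "\<dots> = (\<Sum>j\<in>insert p A. v $ j ^ u * q $ j)"
      by (rule sum.mono_neutral_right) (use A p q_outside in auto)
    also have "\<dots> = (\<Sum>j\<in>insert p A. v $ p ^ u * (\<xi> j ^ (r + s) * q $ j))"
    proof (rule sum.cong[OF refl])
      fix j assume j: "j \<in> insert p A"
      have "v $ j ^ u = \<xi> j ^ (r + s) * v $ p ^ u"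
        by (simp only: v_eq[OF j] power_mult_distrib \<xi>_u)
      then show "v $ j ^ u * q $ j = v $ p ^ u * (\<xi> j ^ (r + s) * q $ j)" by simp
    qed
    also have "\<dots> = 0" using q_pow[OF s] by (simp add: sum_distrib_left[symmetric] del: sum.insert)
    finally show "(?M *\<^sub>v q) $ i = 0\<^sub>v N $ i" using i by simp
  qed simp
  then have "det ?M = 0"
    using q det_0_iff_vec_prod_zero_field[of ?M N] by auto
  then show ?thesis by (simp add: mpoly_eval_alternant U)
qed

text \<open>The Vandermonde determinant is nonzero on the line through \<open>v\<close> and a vector of the subspace
  with distinct coordinates, except at finitely many points.\<close>

lemma alternant_quotient_zero_on_proportional_subspace:
  assumes A: "A \<subseteq> {..<N}" "card A = t" and p: "p < N" "p \<notin> A"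
    and \<zeta>: "\<And>i. i \<in> A \<Longrightarrow> \<zeta> i ^ m = 1" "\<And>i. i \<in> A \<Longrightarrow> \<zeta> i \<noteq> 1" "inj_on \<zeta> A" and m: "m > 0"
    and v: "v \<in> proportional_subspace N p A \<zeta>"
    and U: "card U = N" "finite U" "\<And>u. u \<in> U \<Longrightarrow> \<exists>j s. u = r + j * m + s \<and> s < t"
  shows "mpoly_eval (\<lambda>i. v $ i) (alternant_quotient U) = 0"
proof -
  \<comment> \<open>A vector of the subspace with distinct coordinates: the chosen ones are distinct
    roots of unity, the others distinct integers of norm above 1.\<close>
  define w where "w i = (if i \<in> A then \<zeta> i else if i = p then 1 else of_nat (i + 2))" for i
  have norm_\<zeta>: "norm (\<zeta> i) = 1" if "i \<in> A" for i
    using \<zeta>(1)[OF that] m by (metis norm_power norm_one norm_ge_zero power_eq_1_iff less_irrefl)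
  have norm_large: "norm (of_nat (i + 2) :: complex) > 1" for i
    by (simp only: norm_of_nat)
  have \<zeta>_large: "\<zeta> i \<noteq> of_nat (j + 2)" if "i \<in> A" for i j
    using norm_\<zeta>[OF that] norm_large[of j] by auto
  have one_large: "(1 :: complex) \<noteq> of_nat (j + 2)" for j
    using norm_large[of j] by (metis norm_one less_irrefl)
  have w_inj: "inj_on w {..<N}"
  proof (rule inj_onI)
    fix i j assume "w i = w j"
    then show "i = j"
      using \<zeta>(2)[of i] \<zeta>(2)[of j] inj_onD[OF \<zeta>(3), of i j] \<zeta>_large[of i j] \<zeta>_large[of j i]
        one_large[of i] one_large[of j]
      unfolding w_def by (auto split: if_splits simp del: of_nat_add of_nat_numeral)
  qed
  define x where "x z i = v $ i + z * w i" for z i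
  have vanish: "mpoly_eval (x z) (alternant_quotient U) = 0" if "inj_on (x z) {..<N}" for z
  proof -
    define y where "y = vec N (x z)"
    have y_in: "y \<in> proportional_subspace N p A \<zeta>"
      using v A p by (auto simp: y_def x_def w_def proportional_subspace_def algebra_simps)
    \<comment> \<open>\<open>y\<close> need agree with \<open>x z\<close> only below
      \<open>N\<close>, the only indices that enter the determinant.\<close>
    have "det (mat N N (\<lambda>(i, j). x z j ^ (sorted_list_of_set U ! i)))
        = det (mat N N (\<lambda>(i, j). y $ j ^ (sorted_list_of_set U ! i)))"
      by (rule arg_cong[where f = det], rule eq_matI) (auto simp: y_def)
    also have "\<dots> = 0"
      using alternant_zero_on_proportional_subspace[OF A p \<zeta>(1) y_in U]
      by (simp add: mpoly_eval_alternant U)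
    finally have "mpoly_eval (x z) (alternant U) = 0" by (simp add: mpoly_eval_alternant U)
    then have "mpoly_eval (x z) (alternant_quotient U) * mpoly_eval (x z) (vandermonde N) = 0"
      by (metis mpoly_eval_mult alternant_quotient_mult U(1))
    then show ?thesis using mpoly_eval_vandermonde_nonzero[OF that] by simp
  qed
  \<comment> \<open>Solving \<open>x z i = x z j\<close> for \<open>z\<close> gives these values.
    Pairs with i = j contribute only 0, by division by zero.\<close>
  define Z where "Z = (\<lambda>(i, j). (v $ i - v $ j) / (w j - w i)) ` ({..<N} \<times> {..<N})"
  have good: "inj_on (x z) {..<N}" if "z \<notin> Z" for z
  proof (rule inj_onI, rule ccontr)
    fix i j assume ij: "i \<in> {..<N}" "j \<in> {..<N}" "x z i = x z j" "i \<noteq> j"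
    then have "w j - w i \<noteq> 0" using inj_onD[OF w_inj, of j i] by auto
    then have "z = (v $ i - v $ j) / (w j - w i)"
      using ij(3) by (simp add: x_def field_simps)
    then have "z \<in> Z" using ij by (force simp: Z_def)
    with that show False ..
  qed
  \<comment> \<open>The value 0 may belong to \<open>Z\<close>, but a limit at 0 ignores it; the
    remaining finite set is closed.\<close>
  have "finite (Z - {0})" by (simp add: Z_def)
  then have "open (- (Z - {0}))" by (intro open_Compl finite_imp_closed)
  then have "eventually (\<lambda>z. z \<in> - (Z - {0})) (at 0)" by (rule eventually_at_in_open') simp
  then have "eventually (\<lambda>z. z \<notin> Z) (at 0)"
    using eventually_neq_at_within by eventually_elim auto
  then have ev: "eventually (\<lambda>z. mpoly_eval (x z) (alternant_quotient U) = 0) (at 0)"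
    by eventually_elim (use vanish good in blast)
  have "((\<lambda>z. mpoly_eval (x z) (alternant_quotient U))
      \<longlongrightarrow> mpoly_eval (\<lambda>i. v $ i) (alternant_quotient U)) (at 0)"
  proof (rule tendsto_mpoly_eval)
    show "((\<lambda>z. x z i) \<longlongrightarrow> v $ i) (at 0)" for i
      unfolding x_def by (auto intro!: tendsto_eq_intros)
  qed
  moreover have "((\<lambda>z. mpoly_eval (x z) (alternant_quotient U)) \<longlongrightarrow> 0) (at 0)"
    using ev by (rule tendsto_eventually)
  ultimately show ?thesis using tendsto_unique[OF at_neq_bot] by blast
qed

section \<open>Passage to projective space\<close>

definition projectivization :: "nat \<Rightarrow> complex vec set \<Rightarrow> complex vec set set" where
  "projectivization N W = {P \<in> proj_space N. P \<subseteq> W}"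

text \<open>A subspace can be recovered from its projectivization up to the zero vector, so distinct
  subspaces stay distinct in projective space.\<close>

lemma Union_projectivization:
  assumes W: "VectorSpace.subspace class_ring W (module_vec TYPE(complex) N)"
  shows "\<Union> (projectivization N W) = W - {0\<^sub>v N}"
proof -
  have W_carrier: "W \<subseteq> carrier_vec N" and W_smult: "\<And>c v. v \<in> W \<Longrightarrow> c \<cdot>\<^sub>v v \<in> W"
    using W by (auto simp: VectorSpace.subspace_def submodule_def module_vec_simps)
  show ?thesis
  proof
    show "\<Union> (projectivization N W) \<subseteq> W - {0\<^sub>v N}"
      by (auto simp: projectivization_def proj_space_def quotient_def proj_rel_def)
    show "W - {0\<^sub>v N} \<subseteq> \<Union> (projectivization N W)"
    proof
      fix v assume v: "v \<in> W - {0\<^sub>v N}"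
      let ?P = "proj_rel N `` {v}"
      have "?P \<in> proj_space N"
        unfolding proj_space_def using v W_carrier by (intro quotientI) auto
      moreover have "?P \<subseteq> W" using W_smult v by (auto simp: proj_rel_def)
      moreover have "v \<in> ?P"
        using v W_carrier by (auto simp: proj_rel_def intro!: exI[of _ 1])
      ultimately show "v \<in> \<Union> (projectivization N W)" by (auto simp: projectivization_def)
    qed
  qed
qed

section \<open>Counting the subspaces and telling them apart\<close>

text \<open>Taking the least element of \<open>S\<close> as reference is a canonical choice that
  prevents the same space from arising from several rescaled root assignments.\<close>

definition root_space :: "nat \<Rightarrow> nat set \<Rightarrow> (nat \<Rightarrow> complex) \<Rightarrow> complex vec set" where
  "root_space N S \<zeta> = proportional_subspace N (Min S) (S - {Min S}) \<zeta>"

text \<open>Excluding 1 and requiring injectivity makes all t + 1 ratios distinct, the reference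
  ratio 1 included. Extensional functions let each assignment be counted once.\<close>

definition root_space_data :: "nat \<Rightarrow> nat \<Rightarrow> nat \<Rightarrow> (nat set \<times> (nat \<Rightarrow> complex)) set" where
  "root_space_data N t m =
    (SIGMA S:{S. S \<subseteq> {..<N} \<and> card S = t + 1}.
      {\<zeta> \<in> (S - {Min S}) \<rightarrow>\<^sub>E ({z. z ^ m = 1} - {1}). inj_on \<zeta> (S - {Min S})})"

lemma finite_roots_minus_one: "m > 0 \<Longrightarrow> finite ({z::complex. z ^ m = 1} - {1})"
  using finite_roots_unity[of m] by simp

lemma root_space_dataD:
  assumes "(S, \<zeta>) \<in> root_space_data N t m"
  shows "S \<subseteq> {..<N}" "card S = t + 1" "finite S" "Min S \<in> S" "Min S < N"
    "S - {Min S} \<subseteq> {..<N}" "card (S - {Min S}) = t" "Min S \<notin> S - {Min S}"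
    "\<And>i. i \<in> S - {Min S} \<Longrightarrow> \<zeta> i ^ m = 1" "\<And>i. i \<in> S - {Min S} \<Longrightarrow> \<zeta> i \<noteq> 1"
    "inj_on \<zeta> (S - {Min S})" "\<zeta> \<in> extensional (S - {Min S})"
proof -
  show S: "S \<subseteq> {..<N}" "card S = t + 1" using assms by (auto simp: root_space_data_def)
  then show fin: "finite S" using finite_subset by blast
  show Min: "Min S \<in> S" using S fin by (intro Min_in) auto
  show "Min S < N" "S - {Min S} \<subseteq> {..<N}" "card (S - {Min S}) = t" using S fin Min by auto
qed (use assms in \<open>auto simp: root_space_data_def PiE_iff\<close>)

lemma finite_root_assignments:
  assumes "finite A" "m > 0"
  shows "finite {\<zeta> \<in> A \<rightarrow>\<^sub>E ({z::complex. z ^ m = 1} - {1}). inj_on \<zeta> A}"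
  by (rule finite_subset[of _ "A \<rightarrow>\<^sub>E ({z. z ^ m = 1} - {1})"])
    (use assms finite_roots_minus_one in \<open>auto intro!: finite_PiE\<close>)

lemma finite_root_space_data:
  assumes "m > 0"
  shows "finite (root_space_data N t m)"
  unfolding root_space_data_def
  by (intro finite_SigmaI finite_root_assignments assms) (auto intro: finite_subset[of _ "{..<N}"])

text \<open>Each choice of \<open>S\<close> admits as many assignments as there are injections from
  \<open>t\<close> elements into the m - 1 nontrivial roots of unity, a falling factorial.\<close>

lemma card_root_space_data:
  assumes m: "m > 0"
  shows "int (card (root_space_data N t m)) = int (N choose (t + 1)) * (\<Prod>s = 1..t. int m - int s)"
proof -
  let ?R = "{z::complex. z ^ m = 1} - {1}"
  let ?C = "{S. S \<subseteq> {..<N} \<and> card S = t + 1}"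
  have card_R: "card ?R = m - 1" using m by (simp add: card_roots_unity_eq)
  have fib: "card {\<zeta> \<in> (S - {Min S}) \<rightarrow>\<^sub>E ?R. inj_on \<zeta> (S - {Min S})} = (\<Prod>i<t. m - 1 - i)"
    if "S \<in> ?C" for S
  proof -
    have S: "finite S" "Min S \<in> S" using that finite_subset[of S "{..<N}"] by (auto intro!: Min_in)
    then have "card (S - {Min S}) = t" using that by simp
    then show ?thesis
      using card_inj_on_subset_funcset[of "S - {Min S}" ?R "S - {Min S}"] S
        finite_roots_minus_one[OF m] by (simp add: card_R atLeast0LessThan)
  qed
  have "card (root_space_data N t m)
      = (\<Sum>S\<in>?C. card {\<zeta> \<in> (S - {Min S}) \<rightarrow>\<^sub>E ?R. inj_on \<zeta> (S - {Min S})})"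
    unfolding root_space_data_def
    by (intro card_SigmaI ballI finite_root_assignments m) (auto intro: finite_subset[of _ "{..<N}"])
  also have "\<dots> = card ?C * (\<Prod>i<t. m - 1 - i)" using fib by simp
  also have "card ?C = N choose (t + 1)" using n_subsets[of "{..<N}" "t + 1"] by simp
  finally have 1: "card (root_space_data N t m) = (N choose (t + 1)) * (\<Prod>i<t. m - 1 - i)" .
  \<comment> \<open>Natural subtraction truncates, but if t \<ge> m both products vanish: through
    the factor i = m - 1 on the left and s = m on the right.\<close>
  have "int (\<Prod>i<t. m - 1 - i) = (\<Prod>s = 1..t. int m - int s)"
  proof (cases "t < m")
    case True
    have "int (\<Prod>i<t. m - 1 - i) = (\<Prod>i<t. int m - int (Suc i))"
      unfolding of_nat_prod by (rule prod.cong) (use True in auto)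
    also have "\<dots> = (\<Prod>s = 1..t. int m - int s)"
      by (rule prod.reindex_bij_witness[of _ "\<lambda>s. s - 1" Suc]) auto
    finally show ?thesis .
  next
    case False
    then have "(\<Prod>i<t. m - 1 - i) = 0" using m by (auto intro!: bexI[of _ "m - 1"])
    moreover have "(\<Prod>s = 1..t. int m - int s) = 0"
      using m False by (auto intro!: bexI[of _ m])
    ultimately show ?thesis by (simp only: of_nat_0)
  qed
  with 1 show ?thesis by simp
qed

text \<open>The set \<open>S\<close> consists of the coordinates that are proportional to another coordinate on the
  whole subspace.\<close>

lemma root_space_support:
  assumes D: "(S, \<zeta>) \<in> root_space_data N t m" and t: "t \<ge> 1" and m: "m > 0"
  shows "S = {i. i < N \<and> (\<exists>j c. j < N \<and> j \<noteq> i \<and> (\<forall>v\<in>root_space N S \<zeta>. v $ i = c * v $ j))}"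
    (is "S = ?S'")
proof -
  note D' = root_space_dataD[OF D]
  let ?p = "Min S"
  \<comment> \<open>Since t \<ge> 1, the reference coordinate has a partner \<open>l\<close>, and
    dividing by its nonzero root shows that it too is proportional to another coordinate.\<close>
  have "S - {?p} \<noteq> {}" using D'(7) t by (metis card.empty not_one_le_zero)
  then obtain l where l: "l \<in> S" "l \<noteq> ?p" by blast
  have \<zeta>0: "\<zeta> i \<noteq> 0" if "i \<in> S - {?p}" for i
    using D'(9)[OF that] m by (metis power_0_left zero_neq_one not_less_zero)
  show ?thesis
  proof
    show "S \<subseteq> ?S'"
    proof
      fix i assume i: "i \<in> S"
      show "i \<in> ?S'"
      proof (cases "i = ?p")
        case True
        have "\<forall>v\<in>root_space N S \<zeta>. v $ i = inverse (\<zeta> l) * v $ l"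
          using l \<zeta>0[of l] True by (auto simp: root_space_def proportional_subspace_def)
        then show ?thesis using i l D'(1) True by blast
      next
        case False
        have "\<forall>v\<in>root_space N S \<zeta>. v $ i = \<zeta> i * v $ ?p"
          using i False by (auto simp: root_space_def proportional_subspace_def)
        then show ?thesis using i False D'(1,5) by blast
      qed
    qed
    show "?S' \<subseteq> S"
    proof (rule subsetI, rule ccontr)
      fix i assume "i \<in> ?S'" and iS: "i \<notin> S"
      then obtain j c where i: "i < N" and j: "j < N" "j \<noteq> i"
        and c: "\<And>v. v \<in> root_space N S \<zeta> \<Longrightarrow> v $ i = c * v $ j" by blast
      \<comment> \<open>Coordinate \<open>i\<close> is free and is not the reference, so this vector
        belongs to the space; proportionality would give 1 = c * 0.\<close>
      have "unit_vec N i \<in> root_space N S \<zeta>"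
        using i iS D'(1,4) by (auto simp: root_space_def proportional_subspace_def unit_vec_def subset_iff)
      from c[OF this] show False using i j by simp
    qed
  qed
qed

text \<open>The support lemma recovers \<open>S\<close> from the space; \<zeta> is then read off
  from the vector \<open>b\<close>, whose reference coordinate is 1.\<close>

lemma inj_on_root_space:
  assumes t: "t \<ge> 1" and m: "m > 0"
  shows "inj_on (\<lambda>(S, \<zeta>). root_space N S \<zeta>) (root_space_data N t m)"
proof (rule inj_onI, clarify)
  fix S \<zeta> S' \<zeta>'
  assume D: "(S, \<zeta>) \<in> root_space_data N t m" and D': "(S', \<zeta>') \<in> root_space_data N t m"
    and eq: "root_space N S \<zeta> = root_space N S' \<zeta>'"
  have S: "S' = S"
    using root_space_support[OF D t m] root_space_support[OF D' t m] eq by simp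
  note E = root_space_dataD[OF D] and E' = root_space_dataD[OF D'[unfolded S]]
  let ?p = "Min S"
  define b where "b = vec N (\<lambda>i. if i = ?p then 1 else if i \<in> S then \<zeta> i else 0)"
  have "b \<in> root_space N S \<zeta>"
    using E(5) subsetD[OF E(1)] by (auto simp: b_def root_space_def proportional_subspace_def)
  then have b': "b \<in> root_space N S \<zeta>'" using eq S by simp
  have "\<zeta> = \<zeta>'"
  proof (rule extensionalityI[OF E(12) E'(12)])
    fix i assume i: "i \<in> S - {?p}"
    then have "b $ i = \<zeta>' i * b $ ?p"
      using b' by (simp add: root_space_def proportional_subspace_def)
    then show "\<zeta> i = \<zeta>' i" using i E(5) subsetD[OF E(1), of i] by (auto simp: b_def)
  qed
  then show "S = S' \<and> \<zeta> = \<zeta>'" using S by simp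
qed

lemma root_space_subspace:
  assumes "(S, \<zeta>) \<in> root_space_data N t m"
  shows "VectorSpace.subspace class_ring (root_space N S \<zeta>) (module_vec TYPE(complex) N)"
  unfolding root_space_def
  using root_space_dataD(5,6)[OF assms] by (intro proportional_subspace_subspace)

lemma zero_in_root_space:
  assumes "(S, \<zeta>) \<in> root_space_data N t m"
  shows "0\<^sub>v N \<in> root_space N S \<zeta>"
  using root_space_dataD(5)[OF assms] subsetD[OF root_space_dataD(6)[OF assms]]
  by (auto simp: root_space_def proportional_subspace_def)

theorem mainTheorem11:
  fixes r t m k :: nat and T :: "nat set"
  assumes "t \<ge> 1" and "m \<ge> 1" and "k \<ge> 1"
    and "T = {r + j * m + s | j s. j \<le> k \<and> s \<le> t - 1}"
  shows "\<exists>\<L>. finite \<L> \<and>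
           int (card \<L>) = int ((t + k) choose (k - 1)) * (\<Prod>s = 1..t. int m - int s) \<and>
           (\<forall>L\<in>\<L>. proj_linear_subspace (t + k) (k - 1) L \<and> L \<subseteq> V_locus T (t + k))"
proof -
  define N where "N = t + k"
  define D where "D = root_space_data N t m"
  define \<L> where "\<L> = (\<lambda>(S, \<zeta>). projectivization N (root_space N S \<zeta>)) ` D"
  have m: "m > 0" using assms by simp
  have "inj_on (\<lambda>(S, \<zeta>). projectivization N (root_space N S \<zeta>)) D"
  proof (rule inj_onI, clarify)
    fix S \<zeta> S' \<zeta>'
    assume d: "(S, \<zeta>) \<in> D" "(S', \<zeta>') \<in> D"
      and eq: "projectivization N (root_space N S \<zeta>) = projectivization N (root_space N S' \<zeta>')"
    have "root_space N S \<zeta> - {0\<^sub>v N} = root_space N S' \<zeta>' - {0\<^sub>v N}"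
      using eq d Union_projectivization root_space_subspace unfolding D_def by metis
    moreover have "0\<^sub>v N \<in> root_space N S \<zeta>" "0\<^sub>v N \<in> root_space N S' \<zeta>'"
      using d by (auto simp: D_def intro: zero_in_root_space)
    ultimately have "root_space N S \<zeta> = root_space N S' \<zeta>'" by blast
    then have "(S, \<zeta>) = (S', \<zeta>')"
      using inj_onD[OF inj_on_root_space[OF assms(1) m, of N], of "(S, \<zeta>)" "(S', \<zeta>')"] d
      by (simp add: D_def)
    then show "S = S' \<and> \<zeta> = \<zeta>'" by simp
  qed
  then have "card \<L> = card D" unfolding \<L>_def by (rule card_image)
  \<comment> \<open>Symmetry of binomial coefficients: N - (t + 1) = k - 1, where k \<ge> 1 ensures
    t + 1 \<le> N.\<close>
  moreover have "N choose (t + 1) = (t + k) choose (k - 1)"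
    using binomial_symmetric[of "t + 1" N] assms(3) by (simp add: N_def)
  ultimately have card: "int (card \<L>) = int ((t + k) choose (k - 1)) * (\<Prod>s = 1..t. int m - int s)"
    using card_root_space_data[OF m, of N t] by (simp add: D_def)
  have "finite \<L>" unfolding \<L>_def D_def using finite_root_space_data[OF m] by (rule finite_imageI)
  moreover have "proj_linear_subspace (t + k) (k - 1) L \<and> L \<subseteq> V_locus T (t + k)" if "L \<in> \<L>" for L
  proof -
    obtain S \<zeta> where d: "(S, \<zeta>) \<in> root_space_data N t m"
      and L: "L = projectivization N (root_space N S \<zeta>)"
      using \<open>L \<in> \<L>\<close> by (auto simp: \<L>_def D_def)
    note E = root_space_dataD[OF d]
    \<comment> \<open>The \<open>t\<close> proportionality conditions leave dimension N - t = k,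
      written as k - 1 + 1 to match the projective dimension k - 1.\<close>
    have "vectorspace.dim class_ring (module_vec TYPE(complex) N\<lparr>carrier := root_space N S \<zeta>\<rparr>)
        = k - 1 + 1"
      unfolding root_space_def
      using dim_proportional_subspace[OF E(6,5,8)] E(7) assms(3) by (simp add: N_def)
    then have "proj_linear_subspace N (k - 1) L"
      unfolding proj_linear_subspace_def L projectivization_def
      using root_space_subspace[OF d] by blast
    moreover have "P \<in> V_locus T N" if "P \<in> L" for P
      unfolding V_locus_def
    proof (intro CollectI conjI allI impI ballI)
      show "P \<in> proj_space N" using that by (simp add: L projectivization_def)
      fix U v assume U: "U \<subseteq> T \<and> finite U \<and> card U = N" and v: "v \<in> P"
      have v_in: "v \<in> proportional_subspace N (Min S) (S - {Min S}) \<zeta>"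
        using that v by (auto simp: L projectivization_def root_space_def)
      show "mpoly_eval (\<lambda>i. v $ i) (alternant_quotient U) = 0"
      proof (rule alternant_quotient_zero_on_proportional_subspace[OF E(6,7,5,8-11) m v_in])
        fix u assume "u \<in> U"
        then obtain j s where "u = r + j * m + s" "s \<le> t - 1"
          using U assms(4) by blast
        moreover from this(2) have "s < t" using assms(1) by simp
        ultimately show "\<exists>j s. u = r + j * m + s \<and> s < t" by blast
      qed (use U in auto)
    qed
    ultimately show ?thesis by (auto simp: N_def)
  qed
  ultimately show ?thesis using card by blast
qed

end
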